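(* Let $\Bbbk\in\{\mathbb{R},\mathbb{C}\}$, let $\phi=(\phi_1,\dots,\phi_n):\Bbbk^\ell\to\Bbbk^n$ be a polynomial map, let $\mathcal{X}=\phi(\Bbbk^\ell)$ and $d=\dim\mathcal{X}$, and let $s\ge d$. If $i_1,\dots,i_s\in\{1,\dots,n\}$ are distinct coordinates such that the $s\times\ell$ matrix $$\left[\frac{\partial\phi_{i_p}}{\partial t_j}(t)\right]_{p=1,\dots,s;\ j=1,\dots,\ell}$$ has rank exactly $d$ for at least one $t\in\Bbbk^\ell$, then the coordinate projection $\hat\mu:\Bbbk^n\to\Bbbk^s$, $(x_1,\dots,x_n)\mapsto(x_{i_1},\dots,x_{i_s})$, is generically recoverable when restricted to $\mathcal{X}$.
   Context: $\dim\mathcal{X}$ is the dimension of the Zariski closure $\overline{\mathcal{X}}$ of $\mathcal{X}$ in $\Bbbk^n$ as an algebraic variety over $\Bbbk$; it equals the maximal rank of the Jacobian matrix of $\phi$ over $\Bbbk^\ell$. A map $\mu:\mathcal{X}\to\Bbbk^s$ is recoverable at $x\in\mathcal{X}$ if the fiber $\mu^{-1}(\mu(x))\subseteq\mathcal X$ is finite; it is generically recoverable if it is recoverable at all $x\in\mathcal{X}\cap U$ for some nonempty Zariski open subset $U$ of $\overline{\mathcal{X}}$. *)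

theory Defs
  imports "HOL-Analysis.Analysis" "HOL-Library.Extended_Nat"
begin

section \<open>Polynomial maps\<close>

text \<open>The library's \<open>real_polynomial_function\<close> is polynomial over the reals only; on
  complex vectors it would admit complex conjugation. Hence a version over an arbitrary field.\<close>

inductive poly_fun :: "('k::field ^ 'n \<Rightarrow> 'k) \<Rightarrow> bool" where
  const: "poly_fun (\<lambda>x. c)"
| coord: "poly_fun (\<lambda>x. x $ i)"
| add: "poly_fun f \<Longrightarrow> poly_fun g \<Longrightarrow> poly_fun (\<lambda>x. f x + g x)"
| mult: "poly_fun f \<Longrightarrow> poly_fun g \<Longrightarrow> poly_fun (\<lambda>x. f x * g x)"

definition poly_map :: "('k::field ^ 'l \<Rightarrow> 'k ^ 'n) \<Rightarrow> bool" where
  "poly_map \<phi> \<longleftrightarrow> (\<forall>i. poly_fun (\<lambda>t. \<phi> t $ i))"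

section \<open>The Zariski topology\<close>

definition zariski_closed :: "('k::field ^ 'n) set \<Rightarrow> bool" where
  "zariski_closed Z \<longleftrightarrow> (\<exists>P. (\<forall>p\<in>P. poly_fun p) \<and> Z = {x. \<forall>p\<in>P. p x = 0})"

definition zariski :: "('k::field ^ 'n) topology" where
  "zariski = topology (\<lambda>U. zariski_closed (- U))"

lemma zariski_closed_Un:
  assumes "zariski_closed A" "zariski_closed B"
  shows "zariski_closed (A \<union> B)"
proof -
  obtain P where P: "\<forall>p\<in>P. poly_fun p" "A = {x. \<forall>p\<in>P. p x = 0}"
    using assms(1) unfolding zariski_closed_def by (elim exE conjE)
  obtain Q where Q: "\<forall>p\<in>Q. poly_fun p" "B = {x. \<forall>p\<in>Q. p x = 0}"
    using assms(2) unfolding zariski_closed_def by (elim exE conjE)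
  define R where "R = (\<lambda>(p, q) x. p x * q x) ` (P \<times> Q)"
  have iff: "x \<in> A \<union> B \<longleftrightarrow> (\<forall>r\<in>R. r x = 0)" for x
  proof -
    have "(\<forall>r\<in>R. r x = 0) \<longleftrightarrow> (\<forall>p\<in>P. \<forall>q\<in>Q. p x = 0 \<or> q x = 0)"
      by (simp add: R_def)
    also have "\<dots> \<longleftrightarrow> (\<forall>p\<in>P. p x = 0) \<or> (\<forall>q\<in>Q. q x = 0)" by blast
    finally show ?thesis by (simp only: P(2) Q(2) Un_iff mem_Collect_eq)
  qed
  have "\<forall>r\<in>R. poly_fun r"
  proof
    fix r assume "r \<in> R"
    then obtain p q where "p \<in> P" "q \<in> Q" "r = (\<lambda>x. p x * q x)" by (auto simp: R_def)
    then show "poly_fun r" using P(1) Q(1) by (simp add: poly_fun.mult)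
  qed
  moreover have "A \<union> B = {x. \<forall>r\<in>R. r x = 0}"
    by (rule set_eqI) (simp only: iff mem_Collect_eq)
  ultimately show ?thesis unfolding zariski_closed_def by (intro exI[of _ R] conjI)
qed

lemma zariski_closed_Inter:
  assumes "\<And>Z. Z \<in> \<Z> \<Longrightarrow> zariski_closed Z"
  shows "zariski_closed (\<Inter>\<Z>)"
proof -
  define P where "P = {p. poly_fun p \<and> (\<exists>Z\<in>\<Z>. \<forall>x\<in>Z. p x = 0)}"
  have "\<Inter>\<Z> = {x. \<forall>p\<in>P. p x = 0}"
  proof (intro equalityI subsetI)
    fix x assume "x \<in> {x. \<forall>p\<in>P. p x = 0}"
    then have x: "p x = 0" if "p \<in> P" for p using that by simp
    show "x \<in> \<Inter>\<Z>"
    proof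
      fix Z assume Z: "Z \<in> \<Z>"
      from assms[OF Z] obtain Q where Q: "\<forall>p\<in>Q. poly_fun p" "Z = {x. \<forall>p\<in>Q. p x = 0}"
        unfolding zariski_closed_def by (elim exE conjE)
      have "p x = 0" if p: "p \<in> Q" for p
      proof (rule x)
        have "\<forall>y\<in>Z. p y = 0" using p by (simp add: Q(2))
        moreover have "poly_fun p" using p Q(1) by simp
        ultimately show "p \<in> P" using Z unfolding P_def by (intro CollectI conjI bexI[of _ Z])
      qed
      then show "x \<in> Z" by (simp add: Q(2))
    qed
  next
    fix x assume x: "x \<in> \<Inter>\<Z>"
    have "p x = 0" if "p \<in> P" for p
    proof -
      obtain Z where "Z \<in> \<Z>" "\<forall>x\<in>Z. p x = 0"
        using \<open>p \<in> P\<close> unfolding P_def by blast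
      then show ?thesis using x by simp
    qed
    then show "x \<in> {x. \<forall>p\<in>P. p x = 0}" by simp
  qed
  moreover have "\<forall>p\<in>P. poly_fun p" by (simp add: P_def)
  ultimately show ?thesis unfolding zariski_closed_def by (intro exI[of _ P] conjI)
qed

lemma openin_zariski: "openin zariski U \<longleftrightarrow> zariski_closed (- U)"
proof -
  have "istopology (\<lambda>U :: ('a ^ 'b) set. zariski_closed (- U))"
    unfolding istopology_def
  proof (intro conjI allI impI)
    fix S T :: "('a ^ 'b) set" assume "zariski_closed (- S)" "zariski_closed (- T)"
    then show "zariski_closed (- (S \<inter> T))"
      using zariski_closed_Un[of "- S" "- T"] by (simp add: Compl_Int)
  next
    fix K :: "('a ^ 'b) set set" assume "\<forall>S\<in>K. zariski_closed (- S)"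
    then show "zariski_closed (- \<Union>K)"
      unfolding uminus_Sup by (intro zariski_closed_Inter) blast
  qed
  then show ?thesis by (simp add: zariski_def topology_inverse')
qed

lemma topspace_zariski [simp]: "topspace zariski = UNIV"
proof -
  have "zariski_closed ({} :: ('a ^ 'b) set)"
    unfolding zariski_closed_def by (rule exI[of _ "{\<lambda>x. 1}"]) (auto intro: poly_fun.const)
  then have "openin (zariski :: ('a ^ 'b) topology) UNIV" by (simp add: openin_zariski)
  then show ?thesis using openin_subset by blast
qed

lemma closedin_zariski: "closedin zariski Z \<longleftrightarrow> zariski_closed Z"
  by (simp add: closedin_def openin_zariski Compl_eq_Diff_UNIV[symmetric])

section \<open>Dimension\<close>

definition irreducible_in :: "'a topology \<Rightarrow> 'a set \<Rightarrow> bool" where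
  "irreducible_in T Z \<longleftrightarrow> Z \<subseteq> topspace T \<and> Z \<noteq> {} \<and>
     (\<forall>A B. closedin T A \<longrightarrow> closedin T B \<longrightarrow> Z \<subseteq> A \<union> B \<longrightarrow> Z \<subseteq> A \<or> Z \<subseteq> B)"

text \<open>Supremum of the lengths \<open>m\<close> of chains \<open>Z\<^sub>0 \<subset> \<dots> \<subset> Z\<^sub>m\<close> of irreducible closed subsets.
  The empty space gets dimension 0.\<close>

definition krull_dim :: "'a topology \<Rightarrow> enat" where
  "krull_dim T = Sup {enat m | m. \<exists>Z :: nat \<Rightarrow> 'a set.
     (\<forall>k\<le>m. closedin T (Z k) \<and> irreducible_in T (Z k)) \<and> (\<forall>k<m. Z k \<subset> Z (Suc k))}"

definition variety_dim :: "('k::field ^ 'n) set \<Rightarrow> enat" where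
  "variety_dim X = krull_dim (subtopology zariski (zariski closure_of X))"

section \<open>The Jacobian matrix\<close>

definition partial_deriv :: "('k::real_normed_field ^ 'l \<Rightarrow> 'k) \<Rightarrow> 'l \<Rightarrow> 'k ^ 'l \<Rightarrow> 'k" where
  "partial_deriv f j t = deriv (\<lambda>u. f (t + axis j u)) 0"

text \<open>The rank of the matrix with the \<open>s\<close> rows \<open>\<nabla>\<phi>\<^bsub>i 1\<^esub>(t), \<dots>, \<nabla>\<phi>\<^bsub>i s\<^esub>(t)\<close>. The library's
  \<open>rank A\<close> is \<open>vec.dim (rows A)\<close>, but it indexes rows by a type and so excludes \<open>s = 0\<close>.\<close>

definition jacobian_rank ::
    "('k::real_normed_field ^ 'l \<Rightarrow> 'k ^ 'n) \<Rightarrow> (nat \<Rightarrow> 'n) \<Rightarrow> nat \<Rightarrow> 'k ^ 'l \<Rightarrow> nat" where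
  "jacobian_rank \<phi> i s t =
     vec.dim ((\<lambda>p. \<chi> j. partial_deriv (\<lambda>t. \<phi> t $ i p) j t) ` {1..s})"

section \<open>Recoverability\<close>

definition recoverable_at :: "'a set \<Rightarrow> ('a \<Rightarrow> 'b) \<Rightarrow> 'a \<Rightarrow> bool" where
  "recoverable_at X \<mu> x \<longleftrightarrow> finite {y \<in> X. \<mu> y = \<mu> x}"

definition generically_recoverable :: "('k::field ^ 'n) set \<Rightarrow> ('k ^ 'n \<Rightarrow> 'b) \<Rightarrow> bool" where
  "generically_recoverable X \<mu> \<longleftrightarrow>
     (\<exists>U. openin (subtopology zariski (zariski closure_of X)) U \<and> U \<noteq> {} \<and>
          (\<forall>x \<in> X \<inter> U. recoverable_at X \<mu> x))"

text \<open>The target \<open>k\<^sup>s\<close> is the set of functions on \<open>{1..s}\<close>, extended by \<open>undefined\<close>.\<close>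

definition coord_proj :: "(nat \<Rightarrow> 'n) \<Rightarrow> nat \<Rightarrow> 'k ^ 'n \<Rightarrow> nat \<Rightarrow> 'k" where
  "coord_proj i s x = (\<lambda>p\<in>{1..s}. x $ i p)"

end

theory Submission
  imports Defs
begin

text \<open>Let \<open>t\<close> be a point at which the \<open>s\<close> selected rows of the Jacobian matrix have rank \<open>d\<close>, and pick
  \<open>d\<close> independent ones, belonging to the coordinates \<open>I 0, \<dots>, I (d - 1)\<close>. Vectors \<open>v 0, \<dots>, v (d - 1)\<close>
  dual to these rows span affine spaces \<open>T\<^sub>j = t + \<langle>v 0, \<dots>, v (j - 1)\<rangle>\<close>, and the Zariski closures
  \<open>Z\<^sub>j\<close> of \<open>\<phi> ` T\<^sub>j\<close> are irreducible, because a product of two nonzero polynomials is nonzero on some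
  line (\<open>irreducible_closure_image\<close>).

  The chain \<open>Z\<^sub>0 \<subset> \<dots> \<subset> Z\<^sub>d\<close> is strict: any \<open>j + 1\<close> polynomials on the \<open>j\<close>-dimensional space \<open>T\<^sub>j\<close>
  satisfy a polynomial relation, by counting monomials (\<open>dependent_on_flag\<close>), whereas the selected
  coordinates \<open>I 0, \<dots>, I j\<close> satisfy none on \<open>T\<^sub>j\<^sub>+\<^sub>1\<close>, where to first order at \<open>t\<close> they are the
  linear coordinates (\<open>independent_on_flag\<close>). If \<open>Z\<^sub>d\<close> were not all of the closure \<open>Z\<close> of \<open>range \<phi>\<close>,
  then \<open>Z\<close> would prolong the chain to length \<open>d + 1\<close>. As the dimension is \<open>d\<close>, the image of the single
  \<open>d\<close>-dimensional slice \<open>T\<^sub>d\<close> is Zariski dense in \<open>Z\<close> (\<open>flag_dense\<close>).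

  Now let \<open>m\<close> be any coordinate. By counting once more, the \<open>d + 1\<close> polynomials given by
  \<open>I 0, \<dots>, I (d - 1), m\<close> satisfy a relation on \<open>T\<^sub>d\<close>, and by density it holds on \<open>Z\<close>. Read as a
  polynomial in the \<open>m\<close>-th coordinate, it has a coefficient that does not vanish identically, since the
  coordinates \<open>I 0, \<dots>, I (d - 1)\<close> are independent. Where that coefficient is nonzero, the selected
  coordinates leave only finitely many values for the \<open>m\<close>-th one (\<open>coordinate_relation\<close>). The open set
  required is the one where these coefficients are nonzero for all \<open>m\<close>.\<close>

section \<open>Polynomial functions along lines\<close>

lemma poly_fun_sum:
  assumes "\<And>a. a \<in> S \<Longrightarrow> poly_fun (f a)"
  shows "poly_fun (\<lambda>x. \<Sum>a\<in>S. f a x)"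
  using assms by (induction S rule: infinite_finite_induct) (auto intro: poly_fun.intros)

lemma poly_fun_prod:
  assumes "\<And>a. a \<in> S \<Longrightarrow> poly_fun (f a)"
  shows "poly_fun (\<lambda>x. \<Prod>a\<in>S. f a x)"
  using assms by (induction S rule: infinite_finite_induct) (auto intro: poly_fun.intros)

lemma poly_fun_power:
  assumes "poly_fun f"
  shows "poly_fun (\<lambda>x. f x ^ m)"
  using assms by (induction m) (auto intro: poly_fun.intros)

lemma poly_fun_compose:
  assumes "poly_fun p" "poly_map \<phi>"
  shows "poly_fun (\<lambda>t. p (\<phi> t))"
  using assms(1)
proof induction
  case (coord i)
  then show ?case using assms(2) by (simp add: poly_map_def)
qed (auto intro: poly_fun.intros)

text \<open>Restriction to lines turns \<open>poly_fun\<close> into univariate polynomials. The uniform degree bound \<open>E\<close>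
  serves the counting argument. That the linear coefficient is a linear form in the direction \<open>w\<close> is
  part of the same induction because its product case is the Leibniz rule.\<close>

lemma poly_fun_line:
  fixes p :: "'k::field ^ 'l::finite \<Rightarrow> 'k"
  assumes "poly_fun p"
  shows "\<exists>E. \<forall>x. \<exists>a::'k ^ 'l. \<forall>w. \<exists>q. degree q \<le> E \<and> (\<forall>s. p (x + s *s w) = poly q s) \<and>
           coeff q 1 = (\<Sum>j\<in>UNIV. a $ j * w $ j)"
  using assms
proof induction
  case (const c)
  show ?case
    by (rule exI[of _ 0], rule allI, rule exI[of _ 0], rule allI, rule exI[of _ "[:c:]"]) simp
next
  case (coord i)
  have "(\<Sum>j\<in>UNIV. axis i 1 $ j * w $ j) = w $ i" for w :: "'k ^ 'l"
    by (simp add: axis_def if_distrib[of "\<lambda>x. x * _"] cong: if_cong)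
  then show ?case
    by (intro exI[of _ "1 :: nat"] allI)
       (rule exI[of _ "axis i 1"], rule allI, rule_tac x = "[:x $ i, w $ i:]" in exI, simp)
next
  case (add f g)
  from add.IH obtain E1 where E1: "\<And>x. \<exists>a::'k ^ 'l. \<forall>w. \<exists>q. degree q \<le> E1 \<and>
      (\<forall>s. f (x + s *s w) = poly q s) \<and> coeff q 1 = (\<Sum>j\<in>UNIV. a $ j * w $ j)" by blast
  from add.IH obtain E2 where E2: "\<And>x. \<exists>a::'k ^ 'l. \<forall>w. \<exists>q. degree q \<le> E2 \<and>
      (\<forall>s. g (x + s *s w) = poly q s) \<and> coeff q 1 = (\<Sum>j\<in>UNIV. a $ j * w $ j)" by blast
  show ?case
  proof (rule exI[of _ "max E1 E2"], rule allI)
    fix x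
    obtain a where a: "\<And>w. \<exists>q. degree q \<le> E1 \<and>
      (\<forall>s. f (x + s *s w) = poly q s) \<and> coeff q 1 = (\<Sum>j\<in>UNIV. a $ j * w $ j)" using E1 by blast
    obtain b where b: "\<And>w. \<exists>q. degree q \<le> E2 \<and>
      (\<forall>s. g (x + s *s w) = poly q s) \<and> coeff q 1 = (\<Sum>j\<in>UNIV. b $ j * w $ j)" using E2 by blast
    show "\<exists>a. \<forall>w. \<exists>q. degree q \<le> max E1 E2 \<and> (\<forall>s. f (x + s *s w) + g (x + s *s w) = poly q s) \<and>
      coeff q 1 = (\<Sum>j\<in>UNIV. a $ j * w $ j)"
    proof (rule exI[of _ "a + b"], rule allI)
      fix w
      obtain q q' where "degree q \<le> E1" "\<forall>s. f (x + s *s w) = poly q s"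
          "coeff q 1 = (\<Sum>j\<in>UNIV. a $ j * w $ j)"
          "degree q' \<le> E2" "\<forall>s. g (x + s *s w) = poly q' s"
          "coeff q' 1 = (\<Sum>j\<in>UNIV. b $ j * w $ j)" using a b by meson
      then show "\<exists>q. degree q \<le> max E1 E2 \<and> (\<forall>s. f (x + s *s w) + g (x + s *s w) = poly q s) \<and>
          coeff q 1 = (\<Sum>j\<in>UNIV. (a + b) $ j * w $ j)"
        by (intro exI[of _ "q + q'"])
           (auto simp: degree_add_le sum.distrib algebra_simps intro: degree_add_le_max order_trans)
    qed
  qed
next
  case (mult f g)
  from mult.IH obtain E1 where E1: "\<And>x. \<exists>a::'k ^ 'l. \<forall>w. \<exists>q. degree q \<le> E1 \<and>
      (\<forall>s. f (x + s *s w) = poly q s) \<and> coeff q 1 = (\<Sum>j\<in>UNIV. a $ j * w $ j)" by blast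
  from mult.IH obtain E2 where E2: "\<And>x. \<exists>a::'k ^ 'l. \<forall>w. \<exists>q. degree q \<le> E2 \<and>
      (\<forall>s. g (x + s *s w) = poly q s) \<and> coeff q 1 = (\<Sum>j\<in>UNIV. a $ j * w $ j)" by blast
  show ?case
  proof (rule exI[of _ "E1 + E2"], rule allI)
    fix x
    obtain a where a: "\<And>w. \<exists>q. degree q \<le> E1 \<and>
      (\<forall>s. f (x + s *s w) = poly q s) \<and> coeff q 1 = (\<Sum>j\<in>UNIV. a $ j * w $ j)" using E1 by blast
    obtain b where b: "\<And>w. \<exists>q. degree q \<le> E2 \<and>
      (\<forall>s. g (x + s *s w) = poly q s) \<and> coeff q 1 = (\<Sum>j\<in>UNIV. b $ j * w $ j)" using E2 by blast
    show "\<exists>a. \<forall>w. \<exists>q. degree q \<le> E1 + E2 \<and> (\<forall>s. f (x + s *s w) * g (x + s *s w) = poly q s) \<and>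
      coeff q 1 = (\<Sum>j\<in>UNIV. a $ j * w $ j)"
    proof (rule exI[of _ "f x *s b + g x *s a"], rule allI)
      fix w
      obtain q q' where q: "degree q \<le> E1" "\<And>s. f (x + s *s w) = poly q s"
          "coeff q 1 = (\<Sum>j\<in>UNIV. a $ j * w $ j)"
          and q': "degree q' \<le> E2" "\<And>s. g (x + s *s w) = poly q' s"
          "coeff q' 1 = (\<Sum>j\<in>UNIV. b $ j * w $ j)" using a b by meson
      have 0: "coeff q 0 = f x" "coeff q' 0 = g x"
        using q(2)[of 0] q'(2)[of 0] by (simp_all add: poly_0_coeff_0)
      have "coeff (q * q') 1 = (\<Sum>j\<in>UNIV. (f x *s b + g x *s a) $ j * w $ j)"
        unfolding coeff_mult using q(3) q'(3) 0
        by (simp add: sum.distrib sum_distrib_left algebra_simps atMost_Suc)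
      moreover have "degree (q * q') \<le> E1 + E2"
        using degree_mult_le[of q q'] q(1) q'(1) by linarith
      ultimately show "\<exists>q. degree q \<le> E1 + E2 \<and> (\<forall>s. f (x + s *s w) * g (x + s *s w) = poly q s) \<and>
          coeff q 1 = (\<Sum>j\<in>UNIV. (f x *s b + g x *s a) $ j * w $ j)"
        using q(2) q'(2) by (intro exI[of _ "q * q'"]) auto
    qed
  qed
qed

text \<open>The linear form of \<open>poly_fun_line\<close> is identified by evaluating it on the axes.\<close>

lemma poly_fun_gradient_line:
  fixes p :: "'k::real_normed_field ^ 'l::finite \<Rightarrow> 'k"
  assumes "poly_fun p"
  shows "\<exists>q. (\<forall>s. p (x + s *s w) = poly q s) \<and>
           coeff q 1 = (\<Sum>j\<in>UNIV. partial_deriv p j x * w $ j)"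
proof -
  obtain a :: "'k ^ 'l" where a: "\<And>w. \<exists>q. (\<forall>s. p (x + s *s w) = poly q s) \<and>
      coeff q 1 = (\<Sum>j\<in>UNIV. a $ j * w $ j)"
    using poly_fun_line[OF assms] by meson
  have "partial_deriv p j x = a $ j" for j
  proof -
    obtain q where q: "\<And>s. p (x + s *s axis j 1) = poly q s"
        "coeff q 1 = (\<Sum>i\<in>UNIV. a $ i * axis j 1 $ i)" using a by blast
    have ax: "s *s axis j 1 = (axis j s :: 'k ^ 'l)" for s by (simp add: vec_eq_iff axis_def)
    have "coeff q 1 = a $ j"
      using q(2) by (simp add: axis_def if_distrib[of "\<lambda>x. _ * x"] cong: if_cong)
    moreover have "(\<lambda>u. p (x + axis j u)) = poly q" using q(1) by (auto simp: ax)
    then have "partial_deriv p j x = poly (pderiv q) 0"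
      unfolding partial_deriv_def by (simp add: DERIV_imp_deriv[OF poly_DERIV])
    moreover have "poly (pderiv q) 0 = coeff q 1" by (simp add: poly_0_coeff_0 coeff_pderiv)
    ultimately show ?thesis by simp
  qed
  then show ?thesis using a[of w] by simp
qed

section \<open>Products of nonzero polynomials, and irreducible images\<close>

definition contains_lines :: "('k::field ^ 'l) set \<Rightarrow> bool" where
  "contains_lines A \<longleftrightarrow> (\<forall>x\<in>A. \<forall>y\<in>A. \<forall>s. x + s *s (y - x) \<in> A)"

text \<open>On the line through \<open>x\<close> and \<open>y\<close> both functions are nonzero univariate polynomials, so their
  product has a nonzero value.\<close>

lemma common_nonzero2:
  fixes p q :: "'k::field_char_0 ^ 'l::finite \<Rightarrow> 'k"
  assumes A: "contains_lines A" and p: "poly_fun p" and q: "poly_fun q"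
    and x: "x \<in> A" "p x \<noteq> 0" and y: "y \<in> A" "q y \<noteq> 0"
  obtains z where "z \<in> A" "p z \<noteq> 0" "q z \<noteq> 0"
proof -
  obtain P where P: "\<And>s. p (x + s *s (y - x)) = poly P s" using poly_fun_line[OF p] by meson
  obtain Q where Q: "\<And>s. q (x + s *s (y - x)) = poly Q s" using poly_fun_line[OF q] by meson
  have "poly P 0 \<noteq> 0" "poly Q 1 \<noteq> 0" using P[of 0] Q[of 1] x y by auto
  then have "P * Q \<noteq> 0" by auto
  then obtain s where "poly (P * Q) s \<noteq> 0" using poly_all_0_iff_0 by blast
  then show ?thesis
    using that[of "x + s *s (y - x)"] P Q A x(1) y(1) by (auto simp: contains_lines_def)
qed

lemma common_nonzero:
  fixes p :: "'i \<Rightarrow> 'k::field_char_0 ^ 'l::finite \<Rightarrow> 'k"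
  assumes "finite M" and A: "contains_lines A" "A \<noteq> {}"
    and "\<And>m. m \<in> M \<Longrightarrow> poly_fun (p m)" "\<And>m. m \<in> M \<Longrightarrow> \<exists>x\<in>A. p m x \<noteq> 0"
  shows "\<exists>x\<in>A. \<forall>m\<in>M. p m x \<noteq> 0"
  using assms(1,4,5)
proof (induction M)
  case empty
  then show ?case using A by auto
next
  case (insert m M)
  then obtain x y where x: "x \<in> A" "p m x \<noteq> 0" and y: "y \<in> A" "\<forall>m\<in>M. p m y \<noteq> 0" by blast
  have "poly_fun (\<lambda>x. \<Prod>m\<in>M. p m x)" using insert.prems by (intro poly_fun_prod) auto
  moreover have "(\<Prod>m\<in>M. p m y) \<noteq> 0" using y insert.hyps by simp
  ultimately obtain z where "z \<in> A" "p m z \<noteq> 0" "(\<Prod>m\<in>M. p m z) \<noteq> 0"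
    using common_nonzero2[OF A(1) insert.prems(1) _ x(1,2) y(1)] by blast
  then show ?case using insert.hyps by auto
qed

lemma closedin_zeros: "poly_fun p \<Longrightarrow> closedin zariski {x. p x = 0}"
  unfolding closedin_zariski zariski_closed_def by (rule exI[of _ "{p}"]) simp

lemma vanish_closure:
  assumes "poly_fun p" "\<And>x. x \<in> S \<Longrightarrow> p x = 0" "x \<in> zariski closure_of S"
  shows "p x = 0"
  using closure_of_minimal[OF _ closedin_zeros[OF assms(1)], of S] assms by auto

lemma subset_zariski_closure: "S \<subseteq> zariski closure_of S"
  by (simp add: closure_of_subset)

text \<open>The ambient \<open>Y\<close> is present because \<open>krull_dim\<close> is taken in a subspace of affine space.\<close>

lemma irreducible_closure_image:
  fixes \<phi> :: "'k::field_char_0 ^ 'l::finite \<Rightarrow> 'k ^ 'n::finite"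
  assumes \<phi>: "poly_map \<phi>" and A: "contains_lines A" "A \<noteq> {}"
    and Y: "closedin zariski Y" "zariski closure_of (\<phi> ` A) \<subseteq> Y"
  shows "irreducible_in (subtopology zariski Y) (zariski closure_of (\<phi> ` A))"
  unfolding irreducible_in_def
proof (intro conjI allI impI)
  show "zariski closure_of (\<phi> ` A) \<subseteq> topspace (subtopology zariski Y)" using Y by simp
  show "zariski closure_of (\<phi> ` A) \<noteq> {}" using A(2) subset_zariski_closure[of "\<phi> ` A"] by auto
  fix C D
  assume "closedin (subtopology zariski Y) C" "closedin (subtopology zariski Y) D"
  then have cl: "closedin zariski C" "closedin zariski D" using Y(1) closedin_trans_full by blast+
  assume sub: "zariski closure_of (\<phi> ` A) \<subseteq> C \<union> D"
  have escape: "\<exists>x\<in>A. \<exists>p. poly_fun p \<and> (\<forall>y\<in>B. p y = 0) \<and> p (\<phi> x) \<noteq> 0"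
    if B: "closedin zariski B" "\<not> zariski closure_of (\<phi> ` A) \<subseteq> B" for B
  proof -
    have "\<not> \<phi> ` A \<subseteq> B" using B closure_of_minimal by blast
    moreover obtain P where "\<forall>p\<in>P. poly_fun p" "B = {x. \<forall>p\<in>P. p x = 0}"
      using B(1) unfolding closedin_zariski zariski_closed_def by blast
    ultimately show ?thesis by blast
  qed
  show "zariski closure_of (\<phi> ` A) \<subseteq> C \<or> zariski closure_of (\<phi> ` A) \<subseteq> D"
  proof (rule ccontr)
    assume "\<not> ?thesis"
    then have not_sub: "\<not> zariski closure_of (\<phi> ` A) \<subseteq> C" "\<not> zariski closure_of (\<phi> ` A) \<subseteq> D"
      by simp_all
    from escape[OF cl(1) not_sub(1)] obtain x p where
        x: "x \<in> A" "poly_fun p" "\<forall>y\<in>C. p y = 0" "p (\<phi> x) \<noteq> 0"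
      by (elim bexE exE conjE)
    from escape[OF cl(2) not_sub(2)] obtain y q where
        y: "y \<in> A" "poly_fun q" "\<forall>y\<in>D. q y = 0" "q (\<phi> y) \<noteq> 0"
      by (elim bexE exE conjE)
    obtain z where "z \<in> A" "p (\<phi> z) \<noteq> 0" "q (\<phi> z) \<noteq> 0"
      by (rule common_nonzero2[OF A(1) poly_fun_compose[OF x(2) \<phi>] poly_fun_compose[OF y(2) \<phi>]
            x(1,4) y(1,4)])
    moreover have "\<phi> z \<in> C \<union> D" using sub subset_zariski_closure \<open>z \<in> A\<close> by blast
    ultimately show False using x y by auto
  qed
qed

section \<open>Algebraic independence along a flag\<close>

text \<open>Coefficients \<open>u\<close> are indexed by \<open>nat\<close>, so that the dimension \<open>j\<close> can vary inside a statement.\<close>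

definition flag :: "'k::field ^ 'l \<Rightarrow> (nat \<Rightarrow> 'k ^ 'l) \<Rightarrow> nat \<Rightarrow> ('k ^ 'l) set" where
  "flag t v j = range (\<lambda>u. t + (\<Sum>b<j. u b *s v b))"

lemma contains_lines_flag: "contains_lines (flag t v j)"
  unfolding contains_lines_def
proof (intro ballI allI)
  fix x y s assume "x \<in> flag t v j" "y \<in> flag t v j"
  then obtain u u' where u: "x = t + (\<Sum>b<j. u b *s v b)" "y = t + (\<Sum>b<j. u' b *s v b)"
    by (auto simp: flag_def)
  have "x + s *s (y - x) = t + (\<Sum>b<j. (u b + s * (u' b - u b)) *s v b)"
    by (simp add: u vec_eq_iff sum_subtractf sum.distrib sum_distrib_left algebra_simps)
  then show "x + s *s (y - x) \<in> flag t v j"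
    unfolding flag_def by (simp only:) (rule rangeI)
qed

lemma flag_mono:
  assumes "j \<le> r"
  shows "flag t v j \<subseteq> flag t v r"
proof -
  have "(\<Sum>b<j. u b *s v b) = (\<Sum>b<r. (if b < j then u b else 0) *s v b)" for u
    using assms by (intro sum.mono_neutral_cong_left) auto
  then show ?thesis unfolding flag_def by force
qed

lemma flag_nonempty: "flag t v j \<noteq> {}"
  by (simp add: flag_def)

text \<open>\<open>G 0, \<dots>, G (r - 1)\<close> vanish at \<open>t\<close>, and their differentials at \<open>t\<close> are dual to
  \<open>v 0, \<dots>, v (r - 1)\<close>. Along lines, differentials are coefficients of univariate polynomials, so no
  limits are involved.\<close>

definition first_order_coordinates ::
    "(nat \<Rightarrow> 'k::field ^ 'l \<Rightarrow> 'k) \<Rightarrow> 'k ^ 'l \<Rightarrow> (nat \<Rightarrow> 'k ^ 'l) \<Rightarrow> nat \<Rightarrow> bool" where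
  "first_order_coordinates G t v r \<longleftrightarrow> (\<forall>u. \<forall>a<r. \<exists>q.
     (\<forall>s. G a (t + s *s (\<Sum>b<r. u b *s v b)) = poly q s) \<and> coeff q 0 = 0 \<and> coeff q 1 = u a)"

lemma first_order_coordinates_mono:
  fixes t :: "'k::field ^ 'l::finite"
  assumes "first_order_coordinates G t v d" "r \<le> d"
  shows "first_order_coordinates G t v r"
  unfolding first_order_coordinates_def
proof (intro allI impI)
  fix u :: "nat \<Rightarrow> 'k" and a assume a: "a < r"
  define u' where "u' b = (if b < r then u b else 0)" for b
  have "(\<Sum>b<r. u b *s v b) = (\<Sum>b<d. u' b *s v b)"
    using assms(2) by (intro sum.mono_neutral_cong_left) (auto simp: u'_def)
  moreover have "\<exists>q. (\<forall>s. G a (t + s *s (\<Sum>b<d. u' b *s v b)) = poly q s) \<and>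
      coeff q 0 = 0 \<and> coeff q 1 = u' a"
    using assms a by (simp add: first_order_coordinates_def)
  ultimately show "\<exists>q. (\<forall>s. G a (t + s *s (\<Sum>b<r. u b *s v b)) = poly q s) \<and>
      coeff q 0 = 0 \<and> coeff q 1 = u a"
    using a by (simp add: u'_def)
qed

lemma digits_unique:
  fixes B :: nat
  assumes "\<And>a. a < r \<Longrightarrow> \<alpha> a < B" "\<And>a. a < r \<Longrightarrow> \<beta> a < B"
    and "(\<Sum>a<r. \<alpha> a * B ^ a) = (\<Sum>a<r. \<beta> a * B ^ a)" and "a < r"
  shows "\<alpha> a = \<beta> a"
  using assms
proof (induction r arbitrary: \<alpha> \<beta> a)
  case (Suc r)
  have split: "(\<Sum>a<Suc r. \<gamma> a * B ^ a) = \<gamma> 0 + B * (\<Sum>a<r. \<gamma> (Suc a) * B ^ a)"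
    for \<gamma> :: "nat \<Rightarrow> nat"
    by (simp only: sum.lessThan_Suc_shift) (simp add: sum_distrib_left algebra_simps)
  have lt: "\<alpha> 0 < B" "\<beta> 0 < B" using Suc.prems by auto
  have eq: "\<alpha> 0 + B * (\<Sum>a<r. \<alpha> (Suc a) * B ^ a) = \<beta> 0 + B * (\<Sum>a<r. \<beta> (Suc a) * B ^ a)"
    using Suc.prems(3) by (simp only: split)
  then have 0: "\<alpha> 0 = \<beta> 0" using lt by (metis mod_less mod_mult_self2)
  then have "(\<Sum>a<r. \<alpha> (Suc a) * B ^ a) = (\<Sum>a<r. \<beta> (Suc a) * B ^ a)" using eq lt by simp
  then have "\<alpha> (Suc a) = \<beta> (Suc a)" if "a < r" for a
    using Suc.IH[of "\<lambda>a. \<alpha> (Suc a)" "\<lambda>a. \<beta> (Suc a)" a] Suc.prems(1,2) that by auto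
  then show ?case using 0 Suc.prems(4) by (cases a) auto
qed simp

text \<open>Kronecker substitution: \<open>u a = x ^ (B ^ a)\<close> sends distinct monomials to distinct powers of \<open>x\<close>
  once \<open>B\<close> exceeds all exponents, by uniqueness of digits in base \<open>B\<close>. Exponent vectors are functions
  on \<open>nat\<close>, of which only the restriction to \<open>{..<r}\<close> is visible in the monomial; hence the injectivity
  hypothesis.\<close>

lemma monomials_independent:
  fixes c :: "(nat \<Rightarrow> nat) \<Rightarrow> 'k::field_char_0"
  assumes A: "finite A" "inj_on (\<lambda>\<alpha>. restrict \<alpha> {..<r}) A"
    and zero: "\<And>u. (\<Sum>\<alpha>\<in>A. c \<alpha> * (\<Prod>a<r. u a ^ \<alpha> a)) = 0"
    and "\<alpha> \<in> A"
  shows "c \<alpha> = 0"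
proof -
  define B where "B = Suc (Max ((\<lambda>(\<alpha>, a). \<alpha> a) ` (A \<times> {..<r})))"
  have B: "\<alpha> a < B" if "\<alpha> \<in> A" "a < r" for \<alpha> a
  proof -
    have "\<alpha> a \<in> (\<lambda>(\<alpha>, a). \<alpha> a) ` (A \<times> {..<r})" using that by force
    then show ?thesis unfolding B_def by (simp add: A(1) less_Suc_eq_le)
  qed
  define w where "w \<alpha> = (\<Sum>a<r. \<alpha> a * B ^ a)" for \<alpha> :: "nat \<Rightarrow> nat"
  have inj: "inj_on w A"
  proof (rule inj_onI)
    fix \<alpha> \<beta> assume *: "\<alpha> \<in> A" "\<beta> \<in> A" "w \<alpha> = w \<beta>"
    then have "\<alpha> a = \<beta> a" if "a < r" for a
      using digits_unique[of r \<alpha> B \<beta> a] B that by (simp add: w_def)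
    then have "restrict \<alpha> {..<r} = restrict \<beta> {..<r}" by (auto simp: restrict_def)
    then show "\<alpha> = \<beta>" using A(2) * by (auto dest: inj_onD)
  qed
  define P where "P = (\<Sum>\<alpha>\<in>A. monom (c \<alpha>) (w \<alpha>))"
  have "poly P x = 0" for x
  proof -
    have "(\<Prod>a<r. (x ^ (B ^ a)) ^ \<alpha> a) = x ^ w \<alpha>" for \<alpha>
      by (simp add: w_def power_sum power_mult[symmetric] mult.commute)
    then show ?thesis
      using zero[of "\<lambda>a. x ^ (B ^ a)"] by (simp add: P_def poly_sum poly_monom)
  qed
  then have "P = 0" using poly_all_0_iff_0 by blast
  then have "0 = coeff P (w \<alpha>)" by simp
  also have "\<dots> = (\<Sum>\<beta>\<in>A. if \<beta> = \<alpha> then c \<beta> else 0)"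
    unfolding P_def coeff_sum coeff_monom
    using inj assms(4) by (intro sum.cong) (auto dest: inj_onD)
  also have "\<dots> = c \<alpha>" using A(1) assms(4) by simp
  finally show ?thesis by simp
qed

text \<open>Along the line \<open>s \<mapsto> t + s w\<close> with \<open>w = \<Sum>b<r. u b *s v b\<close>, the function \<open>G a\<close> is \<open>s (u a + O(s))\<close>,
  so the lowest power of \<open>s\<close> in a relation carries the part of least total degree, evaluated at \<open>u\<close>.
  As \<open>u\<close> is arbitrary, that part has only zero coefficients.\<close>

lemma independent_on_flag:
  fixes G :: "nat \<Rightarrow> 'k::field_char_0 ^ 'l::finite \<Rightarrow> 'k"
  assumes A: "finite A" "inj_on (\<lambda>\<alpha>. restrict \<alpha> {..<r}) A"
    and coord: "first_order_coordinates G t v r"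
    and zero: "\<And>x. x \<in> flag t v r \<Longrightarrow> (\<Sum>\<alpha>\<in>A. c \<alpha> * (\<Prod>a<r. G a x ^ \<alpha> a)) = 0"
    and "\<alpha> \<in> A"
  shows "c \<alpha> = 0"
proof (rule ccontr)
  assume "c \<alpha> \<noteq> 0"
  define deg where "deg \<alpha> = (\<Sum>a<r. \<alpha> a)" for \<alpha> :: "nat \<Rightarrow> nat"
  define A' where "A' = {\<alpha>\<in>A. c \<alpha> \<noteq> 0}"
  define m where "m = Min (deg ` A')"
  have A': "finite A'" "\<alpha> \<in> A'" using A(1) assms(5) \<open>c \<alpha> \<noteq> 0\<close> by (auto simp: A'_def)
  have m: "m \<le> deg \<beta>" if "\<beta> \<in> A'" for \<beta> using that A' by (simp add: m_def)
  have "m \<in> deg ` A'" unfolding m_def using A' by (intro Min_in) auto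
  then obtain \<beta> where \<beta>: "\<beta> \<in> A'" "deg \<beta> = m" by auto
  define L where "L = {\<alpha>\<in>A'. deg \<alpha> = m}"
  have L: "finite L" "L \<subseteq> A" "\<beta> \<in> L"
    using A'(1) \<beta> unfolding L_def by (simp, auto simp: A'_def)
  have "(\<Sum>\<alpha>\<in>L. c \<alpha> * (\<Prod>a<r. u a ^ \<alpha> a)) = 0" for u
  proof -
    have "\<exists>p. (\<forall>s. G a (t + s *s (\<Sum>b<r. u b *s v b)) = s * poly p s) \<and> poly p 0 = u a"
      if a: "a < r" for a
    proof -
      obtain q where q: "\<And>s. G a (t + s *s (\<Sum>b<r. u b *s v b)) = poly q s"
          "coeff q 0 = 0" "coeff q 1 = u a"
        using coord a unfolding first_order_coordinates_def by blast
      obtain e p where "q = pCons e p" by (cases q)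
      then show ?thesis using q by (intro exI[of _ p]) (auto simp: poly_0_coeff_0)
    qed
    then have "\<forall>a. \<exists>p. a < r \<longrightarrow> (\<forall>s. G a (t + s *s (\<Sum>b<r. u b *s v b)) = s * poly p s) \<and>
        poly p 0 = u a" by blast
    from choice[OF this] obtain p where p: "\<And>a s. a < r \<Longrightarrow> G a (t + s *s (\<Sum>b<r. u b *s v b)) = s * poly (p a) s"
        "\<And>a. a < r \<Longrightarrow> poly (p a) 0 = u a" by blast
    \<comment> \<open>the relation along the line, divided by \<open>s ^ m\<close>\<close>
    define R where "R = (\<Sum>\<alpha>\<in>A'. smult (c \<alpha>) (monom 1 (deg \<alpha> - m) * (\<Prod>a<r. p a ^ \<alpha> a)))"
    have "poly (monom 1 m * R) s = 0" for s
    proof -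
      have "t + s *s (\<Sum>b<r. u b *s v b) = t + (\<Sum>b<r. (s * u b) *s v b)"
        by (simp add: vec_eq_iff sum_distrib_left algebra_simps)
      then have fl: "t + s *s (\<Sum>b<r. u b *s v b) \<in> flag t v r"
        unfolding flag_def by (simp only:) (rule rangeI)
      have summand: "s ^ m * (c \<alpha> * (s ^ (deg \<alpha> - m) * (\<Prod>a<r. poly (p a) s ^ \<alpha> a))) =
          c \<alpha> * (\<Prod>a<r. G a (t + s *s (\<Sum>b<r. u b *s v b)) ^ \<alpha> a)" if "\<alpha> \<in> A'" for \<alpha>
      proof -
        have "(\<Prod>a<r. G a (t + s *s (\<Sum>b<r. u b *s v b)) ^ \<alpha> a) =
            s ^ deg \<alpha> * (\<Prod>a<r. poly (p a) s ^ \<alpha> a)"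
          by (simp add: p(1) power_mult_distrib prod.distrib deg_def power_sum)
        moreover have "s ^ deg \<alpha> = s ^ m * s ^ (deg \<alpha> - m)"
          using m[OF that] by (simp add: power_add[symmetric])
        ultimately show ?thesis by (simp add: algebra_simps)
      qed
      have "poly (monom 1 m * R) s =
          (\<Sum>\<alpha>\<in>A'. c \<alpha> * (\<Prod>a<r. G a (t + s *s (\<Sum>b<r. u b *s v b)) ^ \<alpha> a))"
        by (simp add: R_def poly_sum poly_monom poly_prod sum_distrib_left summand[symmetric] algebra_simps)
      also have "\<dots> = (\<Sum>\<alpha>\<in>A. c \<alpha> * (\<Prod>a<r. G a (t + s *s (\<Sum>b<r. u b *s v b)) ^ \<alpha> a))"
        using A(1) by (intro sum.mono_neutral_left) (auto simp: A'_def)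
      finally show ?thesis using zero[OF fl] by simp
    qed
    then have "monom 1 m * R = 0" using poly_all_0_iff_0 by blast
    then have "R = 0" by (simp add: monom_eq_0_iff)
    then have "0 = poly R 0" by simp
    also have "\<dots> = (\<Sum>\<alpha>\<in>A'. c \<alpha> * (0 ^ (deg \<alpha> - m) * (\<Prod>a<r. u a ^ \<alpha> a)))"
      by (simp add: R_def poly_sum poly_monom poly_prod p(2))
    also have "\<dots> = (\<Sum>\<alpha>\<in>L. c \<alpha> * (0 ^ (deg \<alpha> - m) * (\<Prod>a<r. u a ^ \<alpha> a)))"
      using A'(1) m by (intro sum.mono_neutral_right) (force simp: L_def power_0_left)+
    also have "\<dots> = (\<Sum>\<alpha>\<in>L. c \<alpha> * (\<Prod>a<r. u a ^ \<alpha> a))"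
      by (intro sum.cong) (auto simp: L_def)
    finally show ?thesis by simp
  qed
  then have "c \<beta> = 0"
    using monomials_independent[of L r c \<beta>] L A(2) inj_on_subset by blast
  then show False using \<beta>(1) by (simp add: A'_def)
qed

text \<open>Gaussian elimination, one equation of \<open>B\<close> at a time.\<close>

lemma underdetermined_system:
  fixes M :: "'a \<Rightarrow> 'b \<Rightarrow> 'k::field"
  assumes "finite B" "finite A" "card B < card A"
  shows "\<exists>c. (\<exists>a\<in>A. c a \<noteq> 0) \<and> (\<forall>b\<in>B. (\<Sum>a\<in>A. c a * M a b) = 0)"
  using assms
proof (induction B arbitrary: A M rule: finite_induct)
  case empty
  then show ?case by (intro exI[of _ "\<lambda>_. 1"]) (auto simp: card_gt_0_iff)
next
  case (insert b B)
  show ?case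
  proof (cases "\<forall>a\<in>A. M a b = 0")
    case True
    obtain c where "\<exists>a\<in>A. c a \<noteq> 0" "\<forall>b\<in>B. (\<Sum>a\<in>A. c a * M a b) = 0"
      using insert.IH[of A M] insert.prems insert.hyps by auto
    then show ?thesis using True by (intro exI[of _ c]) auto
  next
    case False
    then obtain a0 where a0: "a0 \<in> A" "M a0 b \<noteq> 0" by blast
    define A' where "A' = A - {a0}"
    have A': "finite A'" "a0 \<notin> A'" "A = insert a0 A'" using a0 insert.prems by (auto simp: A'_def)
    then have "card B < card A'" using insert.prems insert.hyps by simp
    then obtain c where c: "\<exists>a\<in>A'. c a \<noteq> 0"
        "\<forall>b'\<in>B. (\<Sum>a\<in>A'. c a * (M a b' - M a b / M a0 b * M a0 b')) = 0"
      using insert.IH[OF A'(1), of "\<lambda>a b'. M a b' - M a b / M a0 b * M a0 b'"] by blast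
    \<comment> \<open>\<open>c' a0\<close> solves the equation \<open>b\<close>; the reduced system absorbs its effect on the others\<close>
    define c' where "c' = c(a0 := - (\<Sum>a\<in>A'. c a * M a b) / M a0 b)"
    have sum: "(\<Sum>a\<in>A. c' a * M a b') =
        (\<Sum>a\<in>A'. c a * (M a b' - M a b / M a0 b * M a0 b'))" for b'
    proof -
      have "(\<Sum>a\<in>A. c' a * M a b') = c' a0 * M a0 b' + (\<Sum>a\<in>A'. c' a * M a b')"
        using A' by simp
      also have "(\<Sum>a\<in>A'. c' a * M a b') = (\<Sum>a\<in>A'. c a * M a b')"
        using A'(2) by (intro sum.cong) (auto simp: c'_def)
      also have "c' a0 * M a0 b' = - (\<Sum>a\<in>A'. c a * (M a b / M a0 b * M a0 b'))"
        by (simp add: c'_def sum_distrib_left sum_distrib_right sum_divide_distrib mult.assoc)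
      finally show ?thesis by (simp add: sum_subtractf right_diff_distrib)
    qed
    have "(\<Sum>a\<in>A. c' a * M a b') = 0" if "b' \<in> insert b B" for b'
      unfolding sum using c(2) a0(2) that by auto
    moreover have "\<exists>a\<in>A. c' a \<noteq> 0" using c(1) A' by (auto simp: c'_def)
    ultimately show ?thesis by blast
  qed
qed

text \<open>A nonzero restriction of \<open>F\<close> to a line has fewer than \<open>N\<close> zeros. Hence the coefficients can be
  freed one at a time from the \<open>N\<close> values \<open>0, \<dots>, N - 1\<close>.\<close>

lemma vanish_on_grid:
  fixes F :: "'k::field_char_0 ^ 'l::finite \<Rightarrow> 'k" and j N :: nat
  assumes deg: "\<And>x w. \<exists>q. degree q < N \<and> (\<forall>s. F (x + s *s w) = poly q s)"
    and grid: "\<And>\<beta>. (\<And>b. b < j \<Longrightarrow> \<beta> b < N) \<Longrightarrow> F (x + (\<Sum>b<j. of_nat (\<beta> b) *s v b)) = 0"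
  shows "F (x + (\<Sum>b<j. u b *s v b)) = 0"
  using grid
proof (induction j arbitrary: x u)
  case (Suc j)
  have on_layer: "F (x + of_nat i *s v j + (\<Sum>b<j. u b *s v b)) = 0" if "i < N" for i
  proof (rule Suc.IH)
    fix \<beta> :: "nat \<Rightarrow> nat" assume "\<And>b. b < j \<Longrightarrow> \<beta> b < N"
    then have "\<And>b. b < Suc j \<Longrightarrow> (\<beta>(j := i)) b < N" using that by (auto simp: less_Suc_eq)
    from Suc.prems[of "\<beta>(j := i)", OF this]
    show "F (x + of_nat i *s v j + (\<Sum>b<j. of_nat (\<beta> b) *s v b)) = 0"
      by (simp add: algebra_simps)
  qed
  obtain q where q: "degree q < N" "\<And>s. F (x + (\<Sum>b<j. u b *s v b) + s *s v j) = poly q s"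
    using deg by blast
  have "q = 0"
  proof (rule poly_eqI_degree[where A = "of_nat ` {..<N}"])
    show "poly q y = poly 0 y" if "y \<in> of_nat ` {..<N}" for y
      using that on_layer by (auto simp: q(2)[symmetric] algebra_simps)
  qed (use q(1) in \<open>simp_all add: card_image inj_on_def\<close>)
  then show ?case using q(2)[of "u j"] by (simp add: algebra_simps)
qed simp

lemma degree_prod_le:
  fixes p :: "nat \<Rightarrow> 'k::field poly"
  assumes "\<And>a. a < r \<Longrightarrow> degree (p a) \<le> E"
  shows "degree (\<Prod>a<r. p a) \<le> r * E"
  using assms
proof (induction r)
  case (Suc r)
  then show ?case
    using degree_mult_le[of "\<Prod>a<r. p a" "p r"] Suc.prems[of r]
    by (fastforce simp: algebra_simps)
qed simp

text \<open>If all exponents are at most \<open>D\<close>, there are \<open>(D + 1) ^ r\<close> monomials in the \<open>G a\<close>, of degree \<open>O(D)\<close>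
  on lines. By \<open>vanish_on_grid\<close>, a linear combination of them vanishes on the \<open>j\<close>-dimensional flag if it
  does so at \<open>O(D ^ j)\<close> grid points. As \<open>j < r\<close>, for large \<open>D\<close> these are fewer linear conditions than
  there are coefficients.\<close>

lemma dependent_on_flag:
  fixes G :: "nat \<Rightarrow> 'k::field_char_0 ^ 'l::finite \<Rightarrow> 'k"
  assumes G: "\<And>a. a < r \<Longrightarrow> poly_fun (G a)" and "j < r"
  obtains A c where "finite A" "A \<subseteq> extensional {..<r}" "\<exists>\<alpha>\<in>A. c \<alpha> \<noteq> 0"
    "\<And>x. x \<in> flag t v j \<Longrightarrow> (\<Sum>\<alpha>\<in>A. c \<alpha> * (\<Prod>a<r. G a x ^ \<alpha> a)) = 0"
proof -
  have "\<exists>E. \<forall>x w. \<exists>q. degree q \<le> E \<and> (\<forall>s. G a (x + s *s w) = poly q s)" if "a < r" for a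
    using poly_fun_line[OF G[OF that]] by meson
  then have "\<forall>a. \<exists>E. a < r \<longrightarrow> (\<forall>x w. \<exists>q. degree q \<le> E \<and> (\<forall>s. G a (x + s *s w) = poly q s))"
    by blast
  from choice[OF this] obtain e where e: "\<And>a x w. a < r \<Longrightarrow>
      \<exists>q. degree q \<le> e a \<and> (\<forall>s. G a (x + s *s w) = poly q s)" by blast
  define E where "E = (\<Sum>a<r. e a)"
  have E: "\<exists>q. degree q \<le> E \<and> (\<forall>s. G a (x + s *s w) = poly q s)" if "a < r" for a x w
  proof -
    have "e a \<le> E" unfolding E_def using that by (intro member_le_sum) auto
    then show ?thesis using e[OF that] by (meson order_trans)
  qed
  define C where "C = r * E + 1"
  \<comment> \<open>\<open>N \<le> C (D + 1)\<close>, so \<open>D = C ^ j\<close> makes the \<open>N ^ j\<close> grid points fewer than \<open>(D + 1) ^ (j + 1)\<close>\<close>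
  define D where "D = C ^ j"
  define N where "N = r * (D * E) + 1"
  define A where "A = (\<Pi>\<^sub>E a\<in>{..<r}. {..D})"
  define W where "W = (\<Pi>\<^sub>E b\<in>{..<j}. {..<N})"
  have fin: "finite A" "finite W" unfolding A_def W_def by (auto intro: finite_PiE)
  have "card W < card A"
  proof -
    have "N \<le> C * Suc D" by (simp add: N_def C_def algebra_simps)
    then have "N ^ j \<le> (C * Suc D) ^ j" by (rule power_mono) simp
    also have "\<dots> = D * Suc D ^ j" by (simp only: D_def power_mult_distrib)
    also have "\<dots> < Suc D ^ Suc j" by simp
    also have "\<dots> \<le> Suc D ^ r" using \<open>j < r\<close> by (intro power_increasing) auto
    finally show ?thesis by (simp add: A_def W_def card_PiE)
  qed
  from underdetermined_system[OF fin(2,1) this,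
      of "\<lambda>\<alpha> \<beta>. \<Prod>a<r. G a (t + (\<Sum>b<j. of_nat (\<beta> b) *s v b)) ^ \<alpha> a"]
  obtain c where c: "\<exists>\<alpha>\<in>A. c \<alpha> \<noteq> 0"
    "\<And>\<beta>. \<beta> \<in> W \<Longrightarrow> (\<Sum>\<alpha>\<in>A. c \<alpha> * (\<Prod>a<r. G a (t + (\<Sum>b<j. of_nat (\<beta> b) *s v b)) ^ \<alpha> a)) = 0"
    by blast
  define F where "F x = (\<Sum>\<alpha>\<in>A. c \<alpha> * (\<Prod>a<r. G a x ^ \<alpha> a))" for x
  have "F (t + (\<Sum>b<j. u b *s v b)) = 0" for u
  proof (rule vanish_on_grid[where N = N])
    fix x w
    have "\<forall>a. \<exists>q. a < r \<longrightarrow> degree q \<le> E \<and> (\<forall>s. G a (x + s *s w) = poly q s)"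
      using E by blast
    from choice[OF this] obtain q where q: "\<And>a. a < r \<Longrightarrow> degree (q a) \<le> E"
        "\<And>a s. a < r \<Longrightarrow> G a (x + s *s w) = poly (q a) s" by blast
    have "degree (\<Prod>a<r. q a ^ \<alpha> a) \<le> r * (D * E)" if "\<alpha> \<in> A" for \<alpha>
    proof (rule degree_prod_le)
      fix a assume "a < r"
      then have "\<alpha> a \<le> D" using that by (auto simp: A_def)
      then have "degree (q a) * \<alpha> a \<le> E * D" using q(1)[OF \<open>a < r\<close>] by (rule mult_le_mono[rotated])
      then show "degree (q a ^ \<alpha> a) \<le> D * E" using degree_power_le[of "q a" "\<alpha> a"] by (simp add: mult.commute)
    qed
    then have "degree (\<Sum>\<alpha>\<in>A. smult (c \<alpha>) (\<Prod>a<r. q a ^ \<alpha> a)) \<le> r * (D * E)"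
      using fin(1) by (intro degree_sum_le) (auto intro: order_trans[OF degree_smult_le])
    moreover have "F (x + s *s w) = poly (\<Sum>\<alpha>\<in>A. smult (c \<alpha>) (\<Prod>a<r. q a ^ \<alpha> a)) s" for s
      by (simp add: F_def poly_sum poly_prod q(2))
    ultimately show "\<exists>q. degree q < N \<and> (\<forall>s. F (x + s *s w) = poly q s)"
      by (intro exI[of _ "\<Sum>\<alpha>\<in>A. smult (c \<alpha>) (\<Prod>a<r. q a ^ \<alpha> a)"]) (simp add: N_def)
  next
    fix \<beta> :: "nat \<Rightarrow> nat" assume "\<And>b. b < j \<Longrightarrow> \<beta> b < N"
    then have "restrict \<beta> {..<j} \<in> W" by (auto simp: W_def)
    from c(2)[OF this] show "F (t + (\<Sum>b<j. of_nat (\<beta> b) *s v b)) = 0" by (simp add: F_def)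
  qed
  then show ?thesis
    using fin(1) c(1) by (intro that[of A c]) (auto simp: A_def F_def flag_def PiE_def)
qed

section \<open>A flag adapted to the Jacobian matrix\<close>

text \<open>The vector \<open>v c\<close> represents a linear functional that is 1 on \<open>g c\<close> and 0 on the other \<open>g a\<close>. A functional
  is obtained here as one component of an endomorphism.\<close>

lemma dual_vectors:
  fixes g :: "nat \<Rightarrow> 'k::field ^ 'l::finite"
  assumes "vec.independent (g ` {..<d})" "inj_on g {..<d}"
  obtains v :: "nat \<Rightarrow> 'k ^ 'l"
  where "\<And>a c. a < d \<Longrightarrow> c < d \<Longrightarrow> (\<Sum>j\<in>UNIV. g a $ j * v c $ j) = (if a = c then 1 else 0)"
proof -
  have "\<exists>v. \<forall>a<d. (\<Sum>j\<in>UNIV. g a $ j * v $ j) = (if a = c then 1 else 0)" if c: "c < d" for c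
  proof -
    obtain h :: "'k ^ 'l \<Rightarrow> 'k ^ 'l" where h: "Vector_Spaces.linear (*s) (*s) h"
        "\<And>x. x \<in> g ` {..<d} \<Longrightarrow> h x = (if x = g c then 1 else 0)"
      using vec.linear_independent_extend[OF assms(1), of "\<lambda>x. if x = g c then 1 else 0"] by blast
    interpret h: Vector_Spaces.linear "(*s)" "(*s)" h by (rule h(1))
    obtain j0 :: 'l where True by simp
    define v :: "'k ^ 'l" where "v = (\<chi> j. h (axis j 1) $ j0)"
    have "(\<Sum>j\<in>UNIV. x $ j * v $ j) = h x $ j0" for x
    proof -
      have "h x = h (\<Sum>j\<in>UNIV. x $ j *s axis j 1)" by (simp add: basis_expansion)
      also have "\<dots> = (\<Sum>j\<in>UNIV. x $ j *s h (axis j 1))" by (simp add: h.sum h.scale)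
      finally show ?thesis by (simp add: v_def)
    qed
    moreover have "h (g a) $ j0 = (if a = c then 1 else 0)" if "a < d" for a
      using h(2)[of "g a"] that c assms(2) by (auto dest: inj_onD)
    ultimately show ?thesis by (intro exI[of _ v]) simp
  qed
  then have "\<forall>c. \<exists>v. c < d \<longrightarrow> (\<forall>a<d. (\<Sum>j\<in>UNIV. g a $ j * v $ j) = (if a = c then 1 else 0))"
    by blast
  from choice[OF this] show ?thesis using that by blast
qed

lemma flag_adapted_to_jacobian:
  fixes \<phi> :: "'k::real_normed_field ^ 'l::finite \<Rightarrow> 'k ^ 'n::finite"
  assumes \<phi>: "poly_map \<phi>" and rank: "jacobian_rank \<phi> i s t = d"
  obtains I v where "\<And>a. a < d \<Longrightarrow> I a \<in> i ` {1..s}"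
    "first_order_coordinates (\<lambda>a x. \<phi> x $ I a - \<phi> t $ I a) t v d"
proof -
  define row :: "nat \<Rightarrow> 'k ^ 'l" where "row p = (\<chi> j. partial_deriv (\<lambda>t. \<phi> t $ i p) j t)" for p
  obtain B where B: "B \<subseteq> row ` {1..s}" "vec.independent B" "card B = d"
    using vec.basis_exists[of "row ` {1..s}"] rank unfolding jacobian_rank_def row_def by metis
  have "finite B" using B(1) finite_subset by blast
  then obtain g where "bij_betw g {0..<d} B" using ex_bij_betw_nat_finite B(3) by blast
  then have g: "inj_on g {..<d}" "g ` {..<d} = B" by (auto simp: bij_betw_def atLeast0LessThan)
  have "\<forall>a. \<exists>p. a < d \<longrightarrow> p \<in> {1..s} \<and> g a = row p" using g(2) B(1) by blast
  from choice[OF this] obtain P where P: "\<And>a. a < d \<Longrightarrow> P a \<in> {1..s}" "\<And>a. a < d \<Longrightarrow> g a = row (P a)"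
    by blast
  obtain v :: "nat \<Rightarrow> 'k ^ 'l" where v: "\<And>a c. a < d \<Longrightarrow> c < d \<Longrightarrow>
      (\<Sum>j\<in>UNIV. g a $ j * v c $ j) = (if a = c then 1 else 0)"
    using dual_vectors[of g d] g B(2) by blast
  show ?thesis
  proof (rule that[of "\<lambda>a. i (P a)" v], goal_cases)
    case (1 a)
    then show ?case using P(1) by auto
  next
    case 2
    show ?case unfolding first_order_coordinates_def
    proof (intro allI impI)
      fix u a assume r: "a < d"
      define w where "w = (\<Sum>b<d. u b *s v b)"
      have "poly_fun (\<lambda>t. \<phi> t $ i (P a))" using \<phi> by (simp add: poly_map_def)
      from poly_fun_gradient_line[OF this, of t w]
      obtain q where q: "\<And>s. \<phi> (t + s *s w) $ i (P a) = poly q s"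
          "coeff q 1 = (\<Sum>j\<in>UNIV. row (P a) $ j * w $ j)" by (auto simp: row_def)
      have "(\<Sum>j\<in>UNIV. row (P a) $ j * w $ j) = (\<Sum>j\<in>UNIV. \<Sum>b<d. u b * (g a $ j * v b $ j))"
        using P(2)[of a] r by (simp add: w_def sum_distrib_left algebra_simps)
      also have "\<dots> = (\<Sum>b<d. u b * (\<Sum>j\<in>UNIV. g a $ j * v b $ j))"
        by (subst sum.swap) (simp add: sum_distrib_left)
      also have "\<dots> = (\<Sum>b<d. if b = a then u b else 0)"
        using r v by (intro sum.cong) auto
      also have "\<dots> = u a" using r by simp
      finally have "coeff q 1 = u a" using q(2) by simp
      moreover have "coeff q 0 = \<phi> t $ i (P a)" using q(1)[of 0] by (simp add: poly_0_coeff_0)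
      ultimately show "\<exists>q. (\<forall>s. \<phi> (t + s *s (\<Sum>b<d. u b *s v b)) $ i (P a) - \<phi> t $ i (P a) = poly q s) \<and>
            coeff q 0 = 0 \<and> coeff q 1 = u a"
        using q(1) unfolding w_def by (intro exI[of _ "q - [:\<phi> t $ i (P a):]"]) simp
    qed
  qed
qed

lemma poly_fun_monomial_sum:
  assumes "\<And>a. a < r \<Longrightarrow> poly_fun (G a)"
  shows "poly_fun (\<lambda>x. \<Sum>\<alpha>\<in>A. c \<alpha> * (\<Prod>a<r. G a x ^ \<alpha> a))"
  using assms by (intro poly_fun_sum poly_fun.mult poly_fun.const poly_fun_prod poly_fun_power) auto

lemma poly_fun_coord_diff: "poly_fun (\<lambda>x. x $ m - c)"
  using poly_fun.add[OF poly_fun.coord[of m] poly_fun.const[of "- c"]] by simp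

lemma flag_closures_strict:
  fixes \<phi> :: "'k::field_char_0 ^ 'l::finite \<Rightarrow> 'k ^ 'n::finite"
  assumes \<phi>: "poly_map \<phi>"
    and coord: "first_order_coordinates (\<lambda>a x. \<phi> x $ I a - \<phi> t $ I a) t v (Suc j)"
  shows "zariski closure_of (\<phi> ` flag t v j) \<subset> zariski closure_of (\<phi> ` flag t v (Suc j))"
proof -
  define H where "H a y = y $ I a - \<phi> t $ I a" for a y
  have H: "poly_fun (H a)" for a unfolding H_def by (rule poly_fun_coord_diff)
  obtain A c where A: "finite A" "A \<subseteq> extensional {..<Suc j}" "\<exists>\<alpha>\<in>A. c \<alpha> \<noteq> 0"
      "\<And>x. x \<in> flag t v j \<Longrightarrow> (\<Sum>\<alpha>\<in>A. c \<alpha> * (\<Prod>a<Suc j. H a (\<phi> x) ^ \<alpha> a)) = 0"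
    using dependent_on_flag[of "Suc j" "\<lambda>a x. H a (\<phi> x)" j t v] poly_fun_compose[OF H \<phi>] by blast
  have inj: "inj_on (\<lambda>\<alpha>. restrict \<alpha> {..<Suc j}) A"
    using A(2) by (intro inj_onI) (metis extensional_restrict subsetD)
  have "\<exists>x\<in>flag t v (Suc j). (\<Sum>\<alpha>\<in>A. c \<alpha> * (\<Prod>a<Suc j. H a (\<phi> x) ^ \<alpha> a)) \<noteq> 0"
  proof (rule ccontr)
    assume "\<not> ?thesis"
    then have "c \<alpha> = 0" if "\<alpha> \<in> A" for \<alpha>
      using independent_on_flag[OF A(1) inj, of "\<lambda>a x. H a (\<phi> x)" t v c \<alpha>] coord that
      by (simp add: H_def)
    then show False using A(3) by blast
  qed
  then obtain x where x: "x \<in> flag t v (Suc j)"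
    "(\<Sum>\<alpha>\<in>A. c \<alpha> * (\<Prod>a<Suc j. H a (\<phi> x) ^ \<alpha> a)) \<noteq> 0" by blast
  have "poly_fun (\<lambda>y. \<Sum>\<alpha>\<in>A. c \<alpha> * (\<Prod>a<Suc j. H a y ^ \<alpha> a))"
    by (rule poly_fun_monomial_sum[OF H])
  from vanish_closure[OF this, of "\<phi> ` flag t v j" "\<phi> x"]
  have "\<phi> x \<notin> zariski closure_of (\<phi> ` flag t v j)" using A(4) x(2) by blast
  moreover have "\<phi> x \<in> zariski closure_of (\<phi> ` flag t v (Suc j))"
    using x(1) subset_zariski_closure by blast
  moreover have "zariski closure_of (\<phi> ` flag t v j) \<subseteq> zariski closure_of (\<phi> ` flag t v (Suc j))"
    by (intro closure_of_mono image_mono flag_mono) simp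
  ultimately show ?thesis by blast
qed

text \<open>Otherwise the closure of \<open>range \<phi>\<close> would be a further member on top of the strict chain of the
  closures for \<open>j = 0, \<dots>, d\<close>, giving a chain of length \<open>d + 1\<close>.\<close>

lemma flag_dense:
  fixes \<phi> :: "'k::field_char_0 ^ 'l::finite \<Rightarrow> 'k ^ 'n::finite"
  assumes \<phi>: "poly_map \<phi>" and dim: "variety_dim (range \<phi>) = enat d"
    and coord: "first_order_coordinates (\<lambda>a x. \<phi> x $ I a - \<phi> t $ I a) t v d"
  shows "zariski closure_of (\<phi> ` flag t v d) = zariski closure_of (range \<phi>)"
proof (rule ccontr)
  assume neq: "\<not> ?thesis"
  define Y where "Y = zariski closure_of (range \<phi>)"
  define W where "W k = (if k \<le> d then flag t v k else UNIV)" for k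
  define Z where "Z k = zariski closure_of (\<phi> ` W k)" for k
  have lines: "contains_lines (W k)" "W k \<noteq> {}" for k
    using contains_lines_flag[of t v k] flag_nonempty[of t v k]
    by (auto simp: W_def contains_lines_def)
  have Y: "closedin zariski Y" "Z k \<subseteq> Y" for k
    unfolding Y_def Z_def by (simp_all add: closure_of_mono image_mono)
  have "closedin (subtopology zariski Y) (Z k) \<and> irreducible_in (subtopology zariski Y) (Z k)" for k
    using irreducible_closure_image[OF \<phi> lines Y(1)] Y(2)[of k]
    by (auto simp: Z_def intro: closedin_subset_topspace)
  moreover have "Z k \<subset> Z (Suc k)" if "k < Suc d" for k
  proof (cases "k = d")
    case True
    then show ?thesis using neq Y(2)[of d] by (auto simp: Z_def W_def Y_def)
  next
    case False
    then have "Suc k \<le> d" using that by simp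
    then show ?thesis
      using flag_closures_strict[OF \<phi> first_order_coordinates_mono[OF coord]]
      by (auto simp: Z_def W_def)
  qed
  ultimately have "enat (Suc d) \<le> krull_dim (subtopology zariski Y)"
    unfolding krull_dim_def by (intro Sup_upper) blast
  also have "\<dots> = enat d" using dim by (simp add: variety_dim_def Y_def)
  finally show False by simp
qed

section \<open>Finiteness of the fibres\<close>

lemma finite_vectors:
  assumes "\<And>m. finite (R m)"
  shows "finite {y :: 'k ^ 'n::finite. \<forall>m. y $ m \<in> R m}"
proof (rule finite_imageD)
  have "vec_nth ` {y :: 'k ^ 'n. \<forall>m. y $ m \<in> R m} \<subseteq> (\<Pi>\<^sub>E m\<in>UNIV. R m)" by auto
  then show "finite (vec_nth ` {y :: 'k ^ 'n. \<forall>m. y $ m \<in> R m})"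
    by (rule finite_subset) (use assms in \<open>auto intro: finite_PiE\<close>)
qed (auto simp: inj_on_def vec_nth_inject)

text \<open>A relation between the coordinates \<open>I 0, \<dots>, I (d - 1), m\<close> holds on the flag by counting, and on the whole
  image by density. \<open>L\<close> is its coefficient at some power of the \<open>m\<close>-th coordinate; it is a nontrivial
  combination of monomials in independent functions, so it does not vanish identically.\<close>

lemma coordinate_relation:
  fixes \<phi> :: "'k::field_char_0 ^ 'l::finite \<Rightarrow> 'k ^ 'n::finite"
  assumes \<phi>: "poly_map \<phi>" and dim: "variety_dim (range \<phi>) = enat d"
    and coord: "first_order_coordinates (\<lambda>a x. \<phi> x $ I a - \<phi> t $ I a) t v d"
  shows "\<exists>L. poly_fun L \<and> (\<exists>x. L (\<phi> x) \<noteq> 0) \<and>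
    (\<forall>x\<in>range \<phi>. L x \<noteq> 0 \<longrightarrow> finite {y $ m | y. y \<in> range \<phi> \<and> (\<forall>a<d. y $ I a = x $ I a)})"
proof -
  \<comment> \<open>the shifted coordinates \<open>I a\<close> for \<open>a < d\<close>, and the plain coordinate \<open>m\<close> in position \<open>d\<close>\<close>
  define H where "H a y = y $ (I(d := m)) a - (if a < d then \<phi> t $ I a else 0)" for a y
  have H: "poly_fun (H a)" for a unfolding H_def by (rule poly_fun_coord_diff)
  obtain A c where A: "finite A" "A \<subseteq> extensional {..<Suc d}" "\<exists>\<alpha>\<in>A. c \<alpha> \<noteq> 0"
      "\<And>x. x \<in> flag t v d \<Longrightarrow> (\<Sum>\<alpha>\<in>A. c \<alpha> * (\<Prod>a<Suc d. H a (\<phi> x) ^ \<alpha> a)) = 0"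
    using dependent_on_flag[of "Suc d" "\<lambda>a x. H a (\<phi> x)" d t v] poly_fun_compose[OF H \<phi>] by blast
  have dense: "zariski closure_of (\<phi> ` flag t v d) = zariski closure_of (range \<phi>)"
    by (rule flag_dense[OF \<phi> dim coord])
  have rel: "(\<Sum>\<alpha>\<in>A. c \<alpha> * (\<Prod>a<Suc d. H a y ^ \<alpha> a)) = 0" if "y \<in> range \<phi>" for y
  proof -
    have "y \<in> zariski closure_of (\<phi> ` flag t v d)"
      unfolding dense using that subset_zariski_closure[of "range \<phi>"] by (rule subsetD[rotated])
    moreover have "poly_fun (\<lambda>y. \<Sum>\<alpha>\<in>A. c \<alpha> * (\<Prod>a<Suc d. H a y ^ \<alpha> a))"
      by (rule poly_fun_monomial_sum[OF H])
    note vanish_closure[OF this, of "\<phi> ` flag t v d" y]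
    ultimately show ?thesis using A(4) by blast
  qed
  obtain \<beta> where \<beta>: "\<beta> \<in> A" "c \<beta> \<noteq> 0" using A(3) by blast
  define K where "K = \<beta> d"
  define A' where "A' = {\<alpha>\<in>A. \<alpha> d = K}"
  have A': "finite A'" "\<beta> \<in> A'" using A(1) \<beta> by (auto simp: A'_def K_def)
  have inj: "inj_on (\<lambda>\<alpha>. restrict \<alpha> {..<d}) A'"
  proof (rule inj_onI)
    fix \<alpha> \<gamma> assume *: "\<alpha> \<in> A'" "\<gamma> \<in> A'" "restrict \<alpha> {..<d} = restrict \<gamma> {..<d}"
    have "\<alpha> a = \<gamma> a" if "a < Suc d" for a
    proof (cases "a = d")
      case False
      then show ?thesis using that fun_cong[OF *(3), of a] by simp
    qed (use *(1,2) in \<open>simp add: A'_def\<close>)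
    then show "\<alpha> = \<gamma>" using * A(2)
      by (intro extensionalityI[of _ "{..<Suc d}"]) (auto simp: A'_def)
  qed
  define L where "L y = (\<Sum>\<alpha>\<in>A'. c \<alpha> * (\<Prod>a<d. H a y ^ \<alpha> a))" for y
  have "poly_fun L" unfolding L_def by (rule poly_fun_monomial_sum[OF H])
  moreover have "\<exists>x. L (\<phi> x) \<noteq> 0"
  proof (rule ccontr)
    assume "\<not> ?thesis"
    then have "c \<beta> = 0"
      using independent_on_flag[OF A'(1) inj coord, of c \<beta>] A'(2) by (simp add: L_def H_def)
    then show False using \<beta> by simp
  qed
  moreover have "finite {y $ m | y. y \<in> range \<phi> \<and> (\<forall>a<d. y $ I a = x $ I a)}" if "L x \<noteq> 0" for x
  proof -
    define Q where "Q = (\<Sum>\<alpha>\<in>A. monom (c \<alpha> * (\<Prod>a<d. H a x ^ \<alpha> a)) (\<alpha> d))"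
    have "coeff Q K = (\<Sum>\<alpha>\<in>A. if \<alpha> d = K then c \<alpha> * (\<Prod>a<d. H a x ^ \<alpha> a) else 0)"
      by (simp add: Q_def coeff_sum)
    also have "\<dots> = L x" unfolding L_def A'_def using A(1) by (simp add: sum.inter_filter)
    finally have "Q \<noteq> 0" using that by auto
    have root: "poly Q (y $ m) = 0" if y: "y \<in> range \<phi>" "\<forall>a<d. y $ I a = x $ I a" for y
    proof -
      have "H a y = H a x" if "a < d" for a using y(2) that by (simp add: H_def)
      moreover have "H d y = y $ m" by (simp add: H_def)
      ultimately show ?thesis using rel[OF y(1)]
        by (simp add: Q_def poly_sum poly_monom mult.assoc)
    qed
    have "{y $ m | y. y \<in> range \<phi> \<and> (\<forall>a<d. y $ I a = x $ I a)} \<subseteq> {z. poly Q z = 0}"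
      using root by auto
    then show ?thesis using poly_roots_finite[OF \<open>Q \<noteq> 0\<close>] by (rule finite_subset)
  qed
  ultimately show ?thesis by blast
qed

lemma generically_recoverable_coord_proj:
  fixes \<phi> :: "'k::real_normed_field ^ 'l::finite \<Rightarrow> 'k ^ 'n::finite"
  assumes \<phi>: "poly_map \<phi>" and dim: "variety_dim (range \<phi>) = enat d"
    and rank: "jacobian_rank \<phi> i s t = d"
  shows "generically_recoverable (range \<phi>) (coord_proj i s)"
proof -
  obtain I v where I: "\<And>a. a < d \<Longrightarrow> I a \<in> i ` {1..s}"
    and coord: "first_order_coordinates (\<lambda>a x. \<phi> x $ I a - \<phi> t $ I a) t v d"
    using flag_adapted_to_jacobian[OF \<phi> rank] by blast
  define Y where "Y = zariski closure_of (range \<phi>)"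
  have "\<exists>L. poly_fun L \<and> (\<exists>x. L (\<phi> x) \<noteq> 0) \<and> (\<forall>x\<in>range \<phi>. L x \<noteq> 0 \<longrightarrow>
      finite {y $ m | y. y \<in> range \<phi> \<and> (\<forall>a<d. y $ I a = x $ I a)})" for m
    by (rule coordinate_relation[OF \<phi> dim coord])
  then have "\<forall>m. \<exists>L. poly_fun L \<and> (\<exists>x. L (\<phi> x) \<noteq> 0) \<and> (\<forall>x\<in>range \<phi>. L x \<noteq> 0 \<longrightarrow>
      finite {y $ m | y. y \<in> range \<phi> \<and> (\<forall>a<d. y $ I a = x $ I a)})" by (rule allI)
  from choice[OF this] obtain L where L: "\<And>m. poly_fun (L m)" "\<And>m. \<exists>x. L m (\<phi> x) \<noteq> 0"
    "\<And>m x. x \<in> range \<phi> \<Longrightarrow> L m x \<noteq> 0 \<Longrightarrow>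
      finite {y $ m | y. y \<in> range \<phi> \<and> (\<forall>a<d. y $ I a = x $ I a)}" by blast
  define P where "P x = (\<Prod>m\<in>UNIV. L m x)" for x
  define U where "U = {x. P x \<noteq> 0} \<inter> Y"
  have "closedin zariski {x. P x = 0}"
    unfolding P_def by (intro closedin_zeros poly_fun_prod L(1))
  then have "openin zariski {x. P x \<noteq> 0}"
    by (simp add: closedin_zariski openin_zariski Compl_eq)
  then have "openin (subtopology zariski Y) U"
    unfolding U_def by (rule openin_subtopology_Int)
  moreover have "U \<noteq> {}"
  proof -
    have "\<exists>x\<in>UNIV. \<forall>m\<in>UNIV. L m (\<phi> x) \<noteq> 0"
    proof (rule common_nonzero)
      show "poly_fun (\<lambda>x. L m (\<phi> x))" for m by (rule poly_fun_compose[OF L(1) \<phi>])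
      show "\<exists>x\<in>UNIV. L m (\<phi> x) \<noteq> 0" for m using L(2)[of m] by simp
    qed (simp_all add: contains_lines_def)
    then obtain x where "P (\<phi> x) \<noteq> 0" by (auto simp: P_def)
    moreover have "\<phi> x \<in> Y" unfolding Y_def using subset_zariski_closure[of "range \<phi>"] by blast
    ultimately show ?thesis by (auto simp: U_def)
  qed
  moreover have "recoverable_at (range \<phi>) (coord_proj i s) x" if x: "x \<in> range \<phi> \<inter> U" for x
  proof -
    define R where "R m = {y $ m | y. y \<in> range \<phi> \<and> (\<forall>a<d. y $ I a = x $ I a)}" for m
    have "finite (R m)" for m
      unfolding R_def using x by (intro L(3)) (auto simp: U_def P_def)
    then have "finite {y. \<forall>m. y $ m \<in> R m}" by (rule finite_vectors)
    moreover have "{y \<in> range \<phi>. coord_proj i s y = coord_proj i s x} \<subseteq> {y. \<forall>m. y $ m \<in> R m}"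
    proof clarify
      fix z m assume eq: "coord_proj i s (\<phi> z) = coord_proj i s x"
      have "\<phi> z $ I a = x $ I a" if a: "a < d" for a
      proof -
        obtain p where "p \<in> {1..s}" "I a = i p" using I[OF a] by blast
        then show ?thesis using fun_cong[OF eq, of p] by (simp add: coord_proj_def)
      qed
      then show "\<phi> z $ m \<in> R m" unfolding R_def by blast
    qed
    ultimately show ?thesis unfolding recoverable_at_def by (rule rev_finite_subset)
  qed
  ultimately show ?thesis unfolding generically_recoverable_def Y_def by blast
qed

theorem mainTheorem7:
  fixes i :: "nat \<Rightarrow> 'n::finite" and s d :: nat
  assumes "inj_on i {1..s}" and "s \<ge> d"
  shows "(\<forall>\<phi> :: real ^ 'l::finite \<Rightarrow> real ^ 'n.
            poly_map \<phi> \<longrightarrow> variety_dim (range \<phi>) = enat d \<longrightarrow>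
            (\<exists>t. jacobian_rank \<phi> i s t = d) \<longrightarrow>
            generically_recoverable (range \<phi>) (coord_proj i s))
       \<and> (\<forall>\<phi> :: complex ^ 'l \<Rightarrow> complex ^ 'n.
            poly_map \<phi> \<longrightarrow> variety_dim (range \<phi>) = enat d \<longrightarrow>
            (\<exists>t. jacobian_rank \<phi> i s t = d) \<longrightarrow>
            generically_recoverable (range \<phi>) (coord_proj i s))"
  by (intro conjI allI impI; elim exE; rule generically_recoverable_coord_proj)

end
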